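(* In the fixed-base chain setting of the context, let $i\in\{1,\ldots,N\}$, let $\mathbf{V}_i$ be a matrix with $\mathrm{Range}(\mathbf{V}_i)=\mathcal{V}_i$, and suppose $\mathbf{C}_{i-1}$ is a matrix with $\mathrm{Range}(\mathbf{C}_{i-1}^\top)=\mathcal{K}_{i-1}$ (for $i=1$ one may take $\mathbf{C}_0=\mathbf{0}_{1\times10}$). Put $\mathbf{D}_i=\mathbf{C}_{i-1}\mathbf{B}\big(({}^{J_i}\mathbf{X}_{i-1})^\top\big)$ and $\mathbf A_i=\mathbf{A}(\boldsymbol{\Phi}_i)$. Then the matrix $$\mathbf{C}_i=\begin{bmatrix}\mathbf{D}_i\\ \mathbf{D}_i\mathbf{A}_i\\ \vdots\\ \mathbf{D}_i\mathbf{A}_i^{9}\\ \mathbf{C}(\mathbf{V}_i,\boldsymbol{\Phi}_i)\end{bmatrix}$$ (the observability matrix of the pair $(\mathbf D_i,\mathbf A_i)$ stacked on $\mathbf{C}(\mathbf{V}_i,\boldsymbol{\Phi}_i)$) satisfies $\mathrm{Range}(\mathbf{C}_i^\top)=\mathcal{K}_i$.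
   Context: Spatial notation. For $\mathbf{x}\in\mathbb{R}^3$, $\mathbf{S}(\mathbf{x})$ is the skew-symmetric matrix with $\mathbf{S}(\mathbf{x})\mathbf{y}=\mathbf{x}\times\mathbf{y}$. For $\mathbf{v}=[\boldsymbol{\omega};\mathbf{u}]\in\mathbb{R}^6$, $(\mathbf{v}\times)=\begin{bmatrix}\mathbf{S}(\boldsymbol{\omega})&\mathbf{0}\\ \mathbf{S}(\mathbf{u})&\mathbf{S}(\boldsymbol{\omega})\end{bmatrix}$. A spatial transform is a matrix $\begin{bmatrix}\mathbf{R}&\mathbf{0}\\-\mathbf{R}\mathbf{S}(\mathbf{p})&\mathbf{R}\end{bmatrix}$ with $\mathbf{R}\in SO(3)$, $\mathbf{p}\in\mathbb{R}^3$. Inertial parameters $\boldsymbol{\pi}=[m,h_x,h_y,h_z,I_{xx},I_{xy},I_{xz},I_{yy},I_{yz},I_{zz}]^\top\in\mathbb{R}^{10}$; the linear map $[\boldsymbol{\pi}]^{\wedge}=\begin{bmatrix}\bar{\mathbf{I}}&\mathbf{S}(\mathbf{h})\\ \mathbf{S}(\mathbf{h})^{\top}&m\mathbf{1}_3\end{bmatrix}$ with $\mathbf{h}=[h_x,h_y,h_z]^\top$ and $\bar{\mathbf{I}}$ the symmetric $3\times3$ matrix with entries $I_{xx},I_{xy},\ldots$; $[\cdot]^{\vee}$ is its inverse on the 10-dimensional space of such matrices. Auxiliary matrices: $\mathbf{A}(\boldsymbol{\Phi})\in\mathbb{R}^{10\times10}$ is defined by $\mathbf{A}(\boldsymbol{\Phi})\boldsymbol{\pi}=\big[(\boldsymbol{\Phi}\times)^\top[\boldsymbol{\pi}]^\wedge+[\boldsymbol{\pi}]^\wedge(\boldsymbol{\Phi}\times)\big]^\vee$;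 for a spatial transform $\mathbf{X}$, $\mathbf{B}(\mathbf{X}^\top)\in\mathbb{R}^{10\times10}$ is defined by $\mathbf{B}(\mathbf{X}^\top)\boldsymbol{\pi}=\big[\mathbf{X}^\top[\boldsymbol{\pi}]^\wedge\mathbf{X}\big]^\vee$; for $\mathbf{V}\in\mathbb{R}^{6\times k}$ and $\boldsymbol\Phi\in\mathbb R^6$, $\mathbf{C}(\mathbf{V},\boldsymbol{\Phi})\in\mathbb{R}^{k\times10}$ is the matrix with $\mathbf{C}(\mathbf{V},\boldsymbol{\Phi})\boldsymbol{\pi}=\mathbf{V}^\top[\boldsymbol{\pi}]^\wedge\boldsymbol{\Phi}$. Fixed-base chain. Body $0$ is the fixed ground with $\mathbf{v}_0=\mathbf{0}$. For $i=1,\ldots,N$, joint $i$ has coordinate $q_i$ and $\mathbf{v}_i={}^{i}\mathbf{X}_{i-1}(q_i)\mathbf{v}_{i-1}+\boldsymbol{\Phi}_i\dot q_i$, with $\boldsymbol{\Phi}_i\in\mathbb{R}^6$ fixed, ${}^{i}\mathbf{X}_{i-1}(q_i)={}^{i}\mathbf{X}_{J_i}(q_i)\,{}^{J_i}\mathbf{X}_{i-1}$, ${}^{J_i}\mathbf{X}_{i-1}$ a constant spatial transform, ${}^{i}\mathbf{X}_{J_i}(0)=\mathbf{1}_6$, $\frac{d}{dq_i}{}^{i}\mathbf{X}_{J_i}(q_i)=-(\boldsymbol{\Phi}_i\times){}^{i}\mathbf{X}_{J_i}(q_i)$. $\mathcal{V}_i=\mathrm{span}\{\mathbf{v}_i(\mathbf{q},\dot{\mathbf{q}}):\mathbf{q},\dot{\mathbf{q}}\in\mathbb{R}^N\}$.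 Let $\mathbf{k}:\mathbb{R}^6\to\mathbb{R}^{10}$ satisfy $\mathbf{v}^\top[\boldsymbol{\pi}]^\wedge\mathbf{v}=\mathbf{k}(\mathbf{v})^\top\boldsymbol{\pi}$ for all $\mathbf v,\boldsymbol\pi$; $\mathcal{K}_i=\mathrm{span}\{\mathbf{k}(\mathbf{v}_i(\mathbf{q},\dot{\mathbf{q}})):\mathbf{q},\dot{\mathbf{q}}\in\mathbb{R}^N\}\subseteq\mathbb{R}^{10}$, $\mathcal K_0=\{\mathbf 0\}$. *)

theory Defs
  imports "HOL-Analysis.Analysis" "HOL-Library.Numeral_Type"
begin

text \<open>Spatial vectors: index type 3 + 3; Inl = angular part, Inr = linear part.
  Components of real^3 are indexed 1,2,3 (as in Cross3).\<close>

type_synonym sp = "3 + 3"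

definition skew :: "real^3 \<Rightarrow> real^3^3" where
  "skew x = vector [vector [0, - x$3, x$2], vector [x$3, 0, - x$1], vector [- x$2, x$1, 0]]"

definition blk :: "real^3^3 \<Rightarrow> real^3^3 \<Rightarrow> real^3^3 \<Rightarrow> real^3^3 \<Rightarrow> real^sp^sp" where
  "blk P Q R T = (\<chi> i j. case i of
      Inl a \<Rightarrow> (case j of Inl b \<Rightarrow> P$a$b | Inr b \<Rightarrow> Q$a$b)
    | Inr a \<Rightarrow> (case j of Inl b \<Rightarrow> R$a$b | Inr b \<Rightarrow> T$a$b))"

definition ang :: "real^sp \<Rightarrow> real^3" where "ang v = (\<chi> a. v $ Inl a)"
definition lin :: "real^sp \<Rightarrow> real^3" where "lin v = (\<chi> a. v $ Inr a)"

text \<open>spatial cross product matrix (v \<times>)\<close>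
definition crossM :: "real^sp \<Rightarrow> real^sp^sp" where
  "crossM v = blk (skew (ang v)) 0 (skew (lin v)) (skew (ang v))"

definition SO3 :: "real^3^3 \<Rightarrow> bool" where
  "SO3 R \<longleftrightarrow> orthogonal_matrix R \<and> det R = 1"

definition spatial_transform :: "real^sp^sp \<Rightarrow> bool" where
  "spatial_transform X \<longleftrightarrow> (\<exists>R p. SO3 R \<and> X = blk R 0 (- (R ** skew p)) R)"

text \<open>pi = [m, hx, hy, hz, Ixx, Ixy, Ixz, Iyy, Iyz, Izz] stored at indices 1..10\<close>
definition hat :: "real^10 \<Rightarrow> real^sp^sp" where
  "hat \<pi> = blk (vector [vector [\<pi>$5, \<pi>$6, \<pi>$7], vector [\<pi>$6, \<pi>$8, \<pi>$9], vector [\<pi>$7, \<pi>$9, \<pi>$10]])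
               (skew (vector [\<pi>$2, \<pi>$3, \<pi>$4]))
               (transpose (skew (vector [\<pi>$2, \<pi>$3, \<pi>$4])))
               (\<pi>$1 *\<^sub>R mat 1)"

text \<open>inverse of hat on the 10-dimensional space of such matrices (reads off the entries)\<close>
definition vee :: "real^sp^sp \<Rightarrow> real^10" where
  "vee M = vector [M $ Inr 1 $ Inr 1,
                   M $ Inl 3 $ Inr 2, M $ Inl 1 $ Inr 3, M $ Inl 2 $ Inr 1,
                   M $ Inl 1 $ Inl 1, M $ Inl 1 $ Inl 2, M $ Inl 1 $ Inl 3,
                   M $ Inl 2 $ Inl 2, M $ Inl 2 $ Inl 3, M $ Inl 3 $ Inl 3]"

definition Amat :: "real^sp \<Rightarrow> real^10^10" where
  "Amat \<Phi> = matrix (\<lambda>\<pi>. vee (transpose (crossM \<Phi>) ** hat \<pi> + hat \<pi> ** crossM \<Phi>))"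

text \<open>Bmat Y is B(Y) in the paper; for Y = X^T it satisfies B(X^T) pi = [X^T [pi] X]^vee\<close>
definition Bmat :: "real^sp^sp \<Rightarrow> real^10^10" where
  "Bmat Y = matrix (\<lambda>\<pi>. vee (Y ** hat \<pi> ** transpose Y))"

definition Cmat :: "real^'k^sp \<Rightarrow> real^sp \<Rightarrow> real^10^'k" where
  "Cmat V \<Phi> = matrix (\<lambda>\<pi>. transpose V *v (hat \<pi> *v \<Phi>))"

fun mpow :: "real^'n^'n \<Rightarrow> nat \<Rightarrow> real^'n^'n" where
  "mpow A 0 = mat 1"
| "mpow A (Suc n) = mpow A n ** A"

text \<open>spatial velocities of the chain; q, qd are joint positions/rates (joint j uses q j, j \<ge> 1)\<close>
fun vel :: "(nat \<Rightarrow> real \<Rightarrow> real^sp^sp) \<Rightarrow> (nat \<Rightarrow> real^sp^sp) \<Rightarrow> (nat \<Rightarrow> real^sp)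
            \<Rightarrow> (nat \<Rightarrow> real) \<Rightarrow> (nat \<Rightarrow> real) \<Rightarrow> nat \<Rightarrow> real^sp" where
  "vel XJ XT Phi q qd 0 = 0"
| "vel XJ XT Phi q qd (Suc i) =
     (XJ (Suc i) (q (Suc i)) ** XT (Suc i)) *v vel XJ XT Phi q qd i + qd (Suc i) *\<^sub>R Phi (Suc i)"

definition Vspace :: "(nat \<Rightarrow> real \<Rightarrow> real^sp^sp) \<Rightarrow> (nat \<Rightarrow> real^sp^sp) \<Rightarrow> (nat \<Rightarrow> real^sp)
            \<Rightarrow> nat \<Rightarrow> (real^sp) set" where
  "Vspace XJ XT Phi i = span {vel XJ XT Phi q qd i | q qd. True}"

definition Kspace :: "(real^sp \<Rightarrow> real^10) \<Rightarrow> (nat \<Rightarrow> real \<Rightarrow> real^sp^sp) \<Rightarrow> (nat \<Rightarrow> real^sp^sp)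
            \<Rightarrow> (nat \<Rightarrow> real^sp) \<Rightarrow> nat \<Rightarrow> (real^10) set" where
  "Kspace k XJ XT Phi i = span {k (vel XJ XT Phi q qd i) | q qd. True}"

text \<open>Range of a matrix (column space)\<close>
definition Range :: "real^'c^'r \<Rightarrow> (real^'r) set" where
  "Range M = range (\<lambda>x. M *v x)"

text \<open>The stacked matrix [D; D A; ...; D A^9; Cmat V Phi]; row Inl (j, r) is row r of D A^j,
  where j :: 10 is read as the exponent 0..9\<close>
definition stackC :: "real^10^'r \<Rightarrow> real^10^10 \<Rightarrow> real^10^'k \<Rightarrow> real^10^((10 \<times> 'r) + 'k)" where
  "stackC D A Cv = (\<chi> row. case row of
      Inl (j, r) \<Rightarrow> (D ** mpow A (nat (Rep_bit0 j))) $ r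
    | Inr c \<Rightarrow> Cv $ c)"

end

theory Submission
  imports Defs
begin

text \<open>
  Write \<open>v\<^sub>i = y + q\<^sub>i' \<Phi>\<close> with \<open>y = X\<^sub>J(q\<^sub>i) X v\<^sub>i\<^sub>-\<^sub>1\<close>. Since \<open>k\<close> is quadratic,
  \<open>k(v\<^sub>i) = k(y) + 2 q\<^sub>i' k(y, \<Phi>) + q\<^sub>i'\<^sup>2 k(\<Phi>, \<Phi>)\<close> with \<open>k(\<cdot>,\<cdot>)\<close> its polar form, so \<open>K\<^sub>i\<close> is
  spanned by \<open>k(V\<^sub>i, \<Phi>)\<close> and the vectors \<open>k(X\<^sub>J(t) X v)\<close>. The congruence by \<open>X\<close> acts on \<open>k\<close>
  as \<open>B\<^sup>T\<close>, and \<open>t \<mapsto> k(X\<^sub>J(t) X v)\<close> solves the linear ODE \<open>u' = -A\<^sup>T u\<close>. Hence these curves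
  start in \<open>B\<^sup>T K\<^sub>i\<^sub>-\<^sub>1\<close> and stay in its \<open>A\<^sup>T\<close>-invariant Krylov space, while conversely all
  their derivatives lie in \<open>K\<^sub>i\<close>. The rows of the stacked matrix span exactly this Krylov space
  together with \<open>k(\<cdot>, \<Phi>)\<close> applied to the columns of \<open>V\<^sub>i\<close>.
\<close>

section \<open>Matrix identities and spatial block matrices\<close>

lemma sum_UNIV_sp:
  "(\<Sum>x\<in>(UNIV::sp set). f x) = (\<Sum>a\<in>UNIV. f (Inl a)) + (\<Sum>b\<in>UNIV. f (Inr b))"
  using sum.Plus[of "UNIV::3 set" "UNIV::3 set" f] by (simp add: comp_def)

lemma forall_sp:
  "(\<forall>x::sp. P x) \<longleftrightarrow> P (Inl 1) \<and> P (Inl 2) \<and> P (Inl 3) \<and> P (Inr 1) \<and> P (Inr 2) \<and> P (Inr 3)"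
proof -
  have "(\<forall>x::sp. P x) \<longleftrightarrow> (\<forall>a. P (Inl a)) \<and> (\<forall>b. P (Inr b))"
    by (metis sum.exhaust)
  then show ?thesis by (simp add: forall_3)
qed

lemma blk_nth:
  "blk P Q R T $ Inl a $ Inl b = P$a$b" "blk P Q R T $ Inl a $ Inr b = Q$a$b"
  "blk P Q R T $ Inr a $ Inl b = R$a$b" "blk P Q R T $ Inr a $ Inr b = T$a$b"
  by (simp_all add: blk_def)

lemma blk_mult:
  "blk P Q R T ** blk P' Q' R' T' =
     blk (P ** P' + Q ** R') (P ** Q' + Q ** T') (R ** P' + T ** R') (R ** Q' + T ** T')"
  unfolding vec_eq_iff
  apply (intro allI)
  subgoal for i j
    by (cases i; cases j; simp add: matrix_matrix_mult_def blk_nth sum_UNIV_sp sum.distrib)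
  done

lemma blk_transpose:
  "transpose (blk P Q R T) = blk (transpose P) (transpose R) (transpose Q) (transpose T)"
  unfolding vec_eq_iff
  apply (intro allI)
  subgoal for i j by (cases i; cases j; simp add: transpose_def blk_nth)
  done

lemma matrix_mult_sp_nth:
  "((A::real^sp^sp) ** B) $ i $ j =
     (\<Sum>a\<in>UNIV. A$i$Inl a * B$Inl a$j) + (\<Sum>b\<in>UNIV. A$i$Inr b * B$Inr b$j)"
  by (simp add: matrix_matrix_mult_def sum_UNIV_sp)

lemma crossM_nth:
  "crossM v $ Inl a $ Inl b = skew (ang v) $ a $ b" "crossM v $ Inl a $ Inr b = 0"
  "crossM v $ Inr a $ Inl b = skew (lin v) $ a $ b" "crossM v $ Inr a $ Inr b = skew (ang v) $ a $ b"
  by (simp_all add: crossM_def blk_nth)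

lemma three_cases:
  fixes x :: 3
  obtains "x = 1" | "x = 2" | "x = 3"
  using exhaust_3 by blast

lemma skew_nth:
  "skew x $ 1 $ 1 = 0" "skew x $ 1 $ 2 = - x$3" "skew x $ 1 $ 3 = x$2"
  "skew x $ 2 $ 1 = x$3" "skew x $ 2 $ 2 = 0" "skew x $ 2 $ 3 = - x$1"
  "skew x $ 3 $ 1 = - x$2" "skew x $ 3 $ 2 = x$1" "skew x $ 3 $ 3 = 0"
  by (simp_all add: skew_def)

lemma skew_mult_vec: "skew x *v y = cross3 x y"
  by (simp add: vec_eq_iff forall_3 matrix_vector_mult_def sum_3 skew_nth cross3_simps)

lemma transpose_skew: "transpose (skew x) = - skew x"
  by (simp add: vec_eq_iff forall_3 transpose_def skew_nth)

lemma skew_add_scaleR: "skew (x + c *\<^sub>R y) = skew x + c *\<^sub>R skew y"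
  by (simp add: vec_eq_iff forall_3 skew_nth)

lemma transpose_add: "transpose (A + B) = transpose A + transpose (B::'a::ring_1^'n^'m)"
  by (simp add: vec_eq_iff transpose_def)

lemma transpose_uminus: "transpose (- A) = - transpose (A::'a::ring_1^'n^'m)"
  by (simp add: vec_eq_iff transpose_def)

lemma uminus_matrix_vector_mult: "(- A) *v x = - (A *v (x::real^'n))"
  by (simp add: vec_eq_iff matrix_vector_mult_def sum_negf)

lemma matrix_vector_mult_uminus: "A *v (- x) = - (A *v (x::real^'n))"
  by (simp add: vec_eq_iff matrix_vector_mult_def sum_negf)

lemma matrix_add_rdistrib: "(B + C) ** A = B ** A + C ** (A::real^'p^'n)"
  by (vector matrix_matrix_mult_def sum.distrib[symmetric] field_simps)

lemma inner_matrix_vector_mult: "x \<bullet> (A *v y) = (transpose A *v x) \<bullet> (y::real^'n)"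
  by (simp add: dot_lmul_matrix)

lemma inner_vector_matrix_mult: "w \<bullet> (x v* C) = (C *v w) \<bullet> (x::real^'n)"
  by (metis dot_lmul_matrix inner_commute)

lemma matrix_apply_linear: "linear f \<Longrightarrow> matrix f *v x = f (x::real^'n)"
  by (metis matrix_vector_mul(2))

section \<open>The maps \<open>hat\<close> and \<open>vee\<close>\<close>

lemma hat_nth:
  "hat p $ Inl 1 $ Inl 1 = p$5" "hat p $ Inl 1 $ Inl 2 = p$6" "hat p $ Inl 1 $ Inl 3 = p$7"
  "hat p $ Inl 2 $ Inl 1 = p$6" "hat p $ Inl 2 $ Inl 2 = p$8" "hat p $ Inl 2 $ Inl 3 = p$9"
  "hat p $ Inl 3 $ Inl 1 = p$7" "hat p $ Inl 3 $ Inl 2 = p$9" "hat p $ Inl 3 $ Inl 3 = p$10"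
  "hat p $ Inl a $ Inr b = skew (vector [p$2, p$3, p$4]) $ a $ b"
  "hat p $ Inr a $ Inl b = skew (vector [p$2, p$3, p$4]) $ b $ a"
  "hat p $ Inr a $ Inr b = (if a = b then p$1 else 0)"
  by (simp_all add: hat_def blk_nth transpose_def mat_def)

lemma vee_nth:
  "vee M $ 1 = M $ Inr 1 $ Inr 1" "vee M $ 2 = M $ Inl 3 $ Inr 2" "vee M $ 3 = M $ Inl 1 $ Inr 3"
  "vee M $ 4 = M $ Inl 2 $ Inr 1" "vee M $ 5 = M $ Inl 1 $ Inl 1" "vee M $ 6 = M $ Inl 1 $ Inl 2"
  "vee M $ 7 = M $ Inl 1 $ Inl 3" "vee M $ 8 = M $ Inl 2 $ Inl 2" "vee M $ 9 = M $ Inl 2 $ Inl 3"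
  "vee M $ 10 = M $ Inl 3 $ Inl 3"
  by (simp_all add: vee_def vector_def)

lemma transpose_hat: "transpose (hat p) = hat p"
  unfolding vec_eq_iff forall_sp by (simp add: transpose_def hat_nth forall_3)

lemma hat_add: "hat (p + q) = hat p + hat q"
  unfolding vec_eq_iff forall_sp by (simp add: hat_nth forall_3 skew_nth)

lemma hat_scaleR: "hat (c *\<^sub>R p) = c *\<^sub>R hat p"
  unfolding vec_eq_iff forall_sp by (simp add: hat_nth forall_3 skew_nth)

lemma linear_vee: "linear vee"
  by (rule linearI) (simp_all add: vee_def vec_eq_iff vector_def)

lemma inner_hat_commute: "w \<bullet> (hat p *v v) = v \<bullet> (hat p *v w)"
  by (metis dot_lmul_matrix inner_commute transpose_hat transpose_matrix_vector)

lemma hat_vee_eqI: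
  assumes sym: "transpose M = M"
    and upper_right: "\<And>a b. M $ Inl a $ Inr b = skew q $ a $ b"
    and lower_right: "\<And>a b. M $ Inr a $ Inr b = (if a = b then c else 0)"
  shows "hat (vee M) = M"
proof -
  have M_sym: "M $ j $ i = M $ i $ j" for i j
    using arg_cong[OF sym, of "\<lambda>N. N $ i $ j"] by (simp add: transpose_def)
  have "M $ Inr b $ Inl a = skew q $ a $ b" for a b
    using upper_right[of a b] M_sym[of "Inr b" "Inl a"] by simp
  then show ?thesis
    unfolding vec_eq_iff forall_sp
    by (simp add: hat_nth forall_3 skew_nth vee_nth upper_right lower_right
        M_sym[of "Inl 2" "Inl 1"] M_sym[of "Inl 3" "Inl 1"] M_sym[of "Inl 3" "Inl 2"])
qed

lemma hat_vee_crossM: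
  "hat (vee (transpose (crossM v) ** hat p + hat p ** crossM v)) =
     transpose (crossM v) ** hat p + hat p ** crossM v"
proof (rule hat_vee_eqI[where q = "cross3 (vector [p$2, p$3, p$4]) (ang v) - p$1 *\<^sub>R lin v"
      and c = 0])
  show "transpose (transpose (crossM v) ** hat p + hat p ** crossM v) =
      transpose (crossM v) ** hat p + hat p ** crossM v"
    by (simp add: transpose_add matrix_transpose_mul transpose_hat add.commute)
  show "(transpose (crossM v) ** hat p + hat p ** crossM v) $ Inl a $ Inr b =
      skew (cross3 (vector [p$2, p$3, p$4]) (ang v) - p$1 *\<^sub>R lin v) $ a $ b" for a b
    by (simp add: matrix_mult_sp_nth transpose_def crossM_nth hat_nth sum_3,
        cases a rule: three_cases; cases b rule: three_cases;
        simp add: skew_nth cross3_def ang_def lin_def algebra_simps)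
  show "(transpose (crossM v) ** hat p + hat p ** crossM v) $ Inr a $ Inr b =
      (if a = b then 0 else 0)" for a b
    by (simp add: matrix_mult_sp_nth transpose_def crossM_nth hat_nth sum_3,
        cases a rule: three_cases; cases b rule: three_cases; simp add: skew_nth algebra_simps)
qed

lemma spatial_congruence_upper_right:
  assumes "SO3 R"
  shows "(transpose (blk R 0 (- (R ** skew q)) R) ** hat p ** blk R 0 (- (R ** skew q)) R)
           $ Inl a $ Inr b = skew (transpose R *v vector [p$2, p$3, p$4] + p$1 *\<^sub>R q) $ a $ b"
proof -
  let ?h = "vector [p$2, p$3, p$4] :: real^3"
  have RR: "transpose R ** R = mat 1"
    using assms by (simp add: SO3_def orthogonal_matrix_def)
  have rot: "rotation_matrix (transpose R)"
    using assms by (simp add: SO3_def rotation_matrix_def orthogonal_matrix_transpose det_transpose)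
  have cross: "cross3 (?h v* R) x = cross3 ?h (R *v x) v* R" for x
    using cross_rotation_matrix[OF rot, of ?h "R *v x"] by (simp add: matrix_vector_mul_assoc RR)
  have RRx: "(R *v x) v* R = x" for x
    by (simp flip: transpose_matrix_vector add: matrix_vector_mul_assoc RR)
  have block: "\<And>I. (transpose R ** I + transpose (- (R ** skew q)) ** transpose (skew ?h)) ** 0 +
        (transpose R ** skew ?h + transpose (- (R ** skew q)) ** (p$1 *\<^sub>R mat 1)) ** R
        = skew (transpose R *v ?h + p$1 *\<^sub>R q)"
    unfolding matrix_eq
    by (simp add: matrix_vector_mul_assoc[symmetric] matrix_vector_mult_add_rdistrib
        transpose_uminus matrix_transpose_mul transpose_skew uminus_matrix_vector_mult
        scaleR_matrix_vector_assoc[symmetric] skew_add_scaleR skew_mult_vec cross[symmetric] RRx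
        matrix_vector_mult_scaleR)
  then show ?thesis
    by (simp only: hat_def blk_transpose blk_mult blk_nth block)
qed

lemma spatial_congruence_lower_right:
  assumes "SO3 R"
  shows "(transpose (blk R 0 (- (R ** skew q)) R) ** hat p ** blk R 0 (- (R ** skew q)) R)
           $ Inr a $ Inr b = (if a = b then p$1 else 0)"
proof -
  have "transpose R ** R = mat 1"
    using assms by (simp add: SO3_def orthogonal_matrix_def)
  then have RRx: "(R *v x) v* R = x" for x
    by (metis matrix_vector_mul_assoc matrix_vector_mul_lid transpose_matrix_vector)
  have block: "\<And>S T. (transpose 0 ** T + transpose R ** transpose S) ** 0 +
      (transpose 0 ** S + transpose R ** (p$1 *\<^sub>R mat 1)) ** R = p$1 *\<^sub>R (mat 1 :: real^3^3)"
    unfolding matrix_eq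
    by (simp add: matrix_vector_mul_assoc[symmetric] matrix_vector_mult_add_rdistrib
        scaleR_matrix_vector_assoc[symmetric] RRx matrix_vector_mult_scaleR)
  then show ?thesis
    by (simp only: hat_def blk_transpose blk_mult blk_nth block) (simp add: mat_def)
qed

lemma hat_vee_spatial_congruence:
  assumes "spatial_transform X"
  shows "hat (vee (transpose X ** hat p ** X)) = transpose X ** hat p ** X"
proof -
  obtain R q where R: "SO3 R" and X: "X = blk R 0 (- (R ** skew q)) R"
    using assms unfolding spatial_transform_def by blast
  show ?thesis
  proof (rule hat_vee_eqI)
    show "transpose (transpose X ** hat p ** X) = transpose X ** hat p ** X"
      by (simp add: matrix_transpose_mul transpose_hat matrix_mul_assoc)
  qed (use spatial_congruence_upper_right[OF R] spatial_congruence_lower_right[OF R] X in simp_all)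
qed

lemma linear_vee_congruence: "linear (\<lambda>p. vee (Y ** hat p ** Z))"
proof (rule linearI)
  show "vee (Y ** hat (a + b) ** Z) = vee (Y ** hat a ** Z) + vee (Y ** hat b ** Z)" for a b
    by (simp add: hat_add matrix_add_ldistrib matrix_add_rdistrib linear_add[OF linear_vee])
  show "vee (Y ** hat (c *\<^sub>R a) ** Z) = c *\<^sub>R vee (Y ** hat a ** Z)" for c a
    by (simp add: hat_scaleR matrix_scalar_ac scalar_matrix_assoc[symmetric]
        linear_scale[OF linear_vee])
qed

lemma Bmat_mult_vec: "Bmat Y *v p = vee (Y ** hat p ** transpose Y)"
  unfolding Bmat_def by (rule matrix_apply_linear[OF linear_vee_congruence])

lemma linear_vee_crossM: "linear (\<lambda>p. vee (transpose C ** hat p + hat p ** C))"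
proof (rule linearI)
  show "vee (transpose C ** hat (a + b) + hat (a + b) ** C) =
      vee (transpose C ** hat a + hat a ** C) + vee (transpose C ** hat b + hat b ** C)" for a b
    by (simp add: hat_add matrix_add_ldistrib matrix_add_rdistrib
        linear_add[OF linear_vee, symmetric] algebra_simps)
  show "vee (transpose C ** hat (c *\<^sub>R a) + hat (c *\<^sub>R a) ** C) =
      c *\<^sub>R vee (transpose C ** hat a + hat a ** C)" for c a
    by (simp add: hat_scaleR matrix_scalar_ac scalar_matrix_assoc[symmetric]
        linear_scale[OF linear_vee, symmetric] scaleR_add_right)
qed

lemma Amat_mult_vec: "Amat v *v p = vee (transpose (crossM v) ** hat p + hat p ** crossM v)"
  unfolding Amat_def by (rule matrix_apply_linear[OF linear_vee_crossM])

section \<open>Krylov spaces\<close>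

lemma mpow_commute: "A ** mpow A n = mpow A n ** A"
  by (induction n) (simp_all add: matrix_mul_assoc)

lemma mpow_Suc_mult_vec: "mpow A (Suc j) *v x = A *v (mpow A j *v x)"
  by (simp add: mpow_commute[symmetric] matrix_vector_mul_assoc)

lemma transpose_mpow: "transpose (mpow A n) = mpow (transpose A) n"
  by (induction n) (simp_all add: matrix_transpose_mul mpow_commute)

definition krylov :: "nat \<Rightarrow> real^'n^'n \<Rightarrow> (real^'n) set \<Rightarrow> (real^'n) set" where
  "krylov m M S = span {mpow M j *v x | j x. j < m \<and> x \<in> S}"

lemma subset_krylov: "0 < m \<Longrightarrow> S \<subseteq> krylov m M S"
  unfolding krylov_def by (force intro: span_base)

lemma krylov_mono: "m \<le> m' \<Longrightarrow> krylov m M S \<subseteq> krylov m' M S"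
  unfolding krylov_def by (intro span_mono) force

lemma mult_vec_krylov: "v \<in> krylov m M S \<Longrightarrow> M *v v \<in> krylov (Suc m) M S"
proof -
  assume v: "v \<in> krylov m M S"
  have "M *v (mpow M j *v x) \<in> {mpow M j *v x | j x. j < Suc m \<and> x \<in> S}"
    if "j < m" "x \<in> S" for j x
    unfolding mpow_Suc_mult_vec[symmetric] using that Suc_mono by blast
  then have "(\<lambda>x. M *v x) ` {mpow M j *v x | j x. j < m \<and> x \<in> S}
      \<subseteq> {mpow M j *v x | j x. j < Suc m \<and> x \<in> S}"
    by blast
  then have "span ((\<lambda>x. M *v x) ` {mpow M j *v x | j x. j < m \<and> x \<in> S}) \<subseteq> krylov (Suc m) M S"
    unfolding krylov_def by (rule span_mono)
  moreover have "linear ((*v) M)" by simp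
  ultimately show ?thesis
    using v unfolding krylov_def span_linear_image[OF \<open>linear ((*v) M)\<close>] by blast
qed

lemma krylov_Suc_stable:
  assumes "krylov m M S = krylov (Suc m) M S"
  shows "krylov (Suc m) M S = krylov (Suc (Suc m)) M S"
proof
  show "krylov (Suc m) M S \<subseteq> krylov (Suc (Suc m)) M S" by (rule krylov_mono) simp
  show "krylov (Suc (Suc m)) M S \<subseteq> krylov (Suc m) M S"
    unfolding krylov_def[of "Suc (Suc m)"]
  proof (rule span_minimal, safe)
    fix j x assume j: "j < Suc (Suc m)" and x: "x \<in> S"
    show "mpow M j *v x \<in> krylov (Suc m) M S"
    proof (cases j)
      case 0
      with x subset_krylov[of "Suc m" S M] show ?thesis by auto
    next
      case (Suc j')
      with j x have "mpow M j' *v x \<in> krylov m M S"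
        unfolding assms unfolding krylov_def by (intro span_base) auto
      then have "M *v (mpow M j' *v x) \<in> krylov (Suc m) M S" by (rule mult_vec_krylov)
      then show ?thesis by (simp only: Suc mpow_Suc_mult_vec)
    qed
  qed (simp add: krylov_def)
qed

text \<open>A strictly increasing chain of subspaces of \<open>\<real>\<^sup>n\<close> has length at most \<open>n\<close>.\<close>

lemma krylov_stable_CARD: "krylov CARD('n) M S = krylov (Suc CARD('n)) M (S :: (real^'n) set)"
proof -
  have "\<exists>m\<le>CARD('n). krylov m M S = krylov (Suc m) M S"
  proof (rule ccontr)
    assume "\<not> ?thesis"
    then have grows: "krylov m M S \<subset> krylov (Suc m) M S" if "m \<le> CARD('n)" for m
      using krylov_mono[of m "Suc m" M S] that by auto
    have "m \<le> dim (krylov m M S)" if "m \<le> Suc CARD('n)" for m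
      using that
    proof (induction m)
      case (Suc m)
      have "dim (krylov m M S) < dim (krylov (Suc m) M S)"
        unfolding krylov_def dim_span
        by (rule grows[unfolded krylov_def, THEN dim_psubset]) (use Suc.prems in simp)
      with Suc show ?case by simp
    qed simp
    then have "Suc CARD('n) \<le> dim (krylov (Suc CARD('n)) M S)" by simp
    with dim_subset_UNIV_cart[of "krylov (Suc CARD('n)) M S"] show False by simp
  qed
  then obtain m where m: "m \<le> CARD('n)" "krylov m M S = krylov (Suc m) M S" by blast
  have "krylov (m + d) M S = krylov (Suc (m + d)) M S" for d
  proof (induction d)
    case (Suc d)
    then show ?case using krylov_Suc_stable[of "m + d"] by simp
  qed (use m in simp)
  from this[of "CARD('n) - m"] m show ?thesis by simp
qed

lemma krylov_invariant: "v \<in> krylov CARD('n) M S \<Longrightarrow> M *v v \<in> krylov CARD('n) M (S :: (real^'n) set)"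
  using mult_vec_krylov krylov_stable_CARD by blast

lemma krylov_span: "krylov m M (span S) = krylov m M S"
proof
  show "krylov m M S \<subseteq> krylov m M (span S)"
    unfolding krylov_def by (intro span_mono) (auto intro: span_base)
  show "krylov m M (span S) \<subseteq> krylov m M S"
    unfolding krylov_def[of m M "span S"]
  proof (rule span_minimal, safe)
    fix j x assume j: "j < m" and x: "x \<in> span S"
    have "linear ((*v) (mpow M j))" by simp
    then have "(*v) (mpow M j) ` span S = span ((*v) (mpow M j) ` S)"
      by (simp add: span_linear_image)
    also have "\<dots> \<subseteq> krylov m M S"
      unfolding krylov_def using j by (intro span_mono) auto
    finally show "mpow M j *v x \<in> krylov m M S" using x by blast
  qed (simp add: krylov_def)
qed

section \<open>Invariant subspaces of linear ODEs\<close>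

lemma gronwall_zero_nonneg:
  fixes g g' :: "real \<Rightarrow> real"
  assumes der: "\<And>t. (g has_real_derivative g' t) (at t)"
    and bound: "\<And>t. g' t \<le> c * g t"
    and nonneg: "\<And>t. g t \<ge> 0"
    and g0: "g 0 = 0"
    and t: "t \<ge> 0"
  shows "g t = 0"
proof -
  define h where "h x = g x * exp (- c * x)" for x
  have "h t \<le> h 0"
  proof (rule DERIV_nonpos_imp_nonincreasing[OF t])
    fix x :: real
    have "(h has_real_derivative g' x * exp (- c * x) + g x * (exp (- c * x) * (- c))) (at x)"
      unfolding h_def by (auto intro!: derivative_eq_intros der)
    moreover have "g' x * exp (- c * x) \<le> c * g x * exp (- c * x)"
      using bound[of x] by (rule mult_right_mono) simp
    ultimately show "\<exists>y. DERIV h x :> y \<and> y \<le> 0"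
      by (intro exI conjI) (auto simp: algebra_simps)
  qed
  then have "g t \<le> 0" using g0 by (simp add: h_def mult_le_0_iff)
  with nonneg[of t] show ?thesis by linarith
qed

lemma gronwall_zero:
  fixes g g' :: "real \<Rightarrow> real"
  assumes der: "\<And>t. (g has_real_derivative g' t) (at t)"
    and bound: "\<And>t. \<bar>g' t\<bar> \<le> c * g t"
    and nonneg: "\<And>t. g t \<ge> 0"
    and g0: "g 0 = 0"
  shows "g t = 0"
proof (cases "t \<ge> 0")
  case True
  show ?thesis
  proof (rule gronwall_zero_nonneg[OF der])
    show "g' x \<le> c * g x" for x using bound[of x] by (simp add: abs_le_iff)
  qed (use nonneg g0 True in auto)
next
  case False
  have der_reflected: "((\<lambda>x. g (- x)) has_real_derivative - g' (- x)) (at x)" for x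
    using DERIV_chain2[OF der DERIV_minus[OF DERIV_ident]] by simp
  have "g (- (- t)) = 0"
  proof (rule gronwall_zero_nonneg[OF der_reflected])
    show "- g' (- x) \<le> c * g (- x)" for x using bound[of "- x"] by (simp add: abs_le_iff)
  qed (use nonneg g0 False in auto)
  then show ?thesis by simp
qed

lemma has_vector_derivative_in_subspace:
  fixes f :: "real \<Rightarrow> 'a::euclidean_space"
  assumes S: "subspace S" and f: "\<And>t. f t \<in> S" and der: "(f has_vector_derivative f') (at t)"
  shows "f' \<in> S"
proof -
  obtain y z where y: "y \<in> span S" and z: "\<And>w. w \<in> span S \<Longrightarrow> orthogonal z w" and f': "f' = y + z"
    using orthogonal_subspace_decomp_exists by blast
  have "((\<lambda>t. z \<bullet> f t) has_vector_derivative z \<bullet> f') (at t)"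
    using bounded_linear.has_vector_derivative[OF bounded_linear_inner_right der] by simp
  moreover have "(\<lambda>t. z \<bullet> f t) = (\<lambda>t. 0)"
    using z f by (auto simp: orthogonal_def span_base)
  ultimately have "z \<bullet> f' = 0"
    using vector_derivative_unique_at[of "\<lambda>t. 0" "z \<bullet> f'" t 0] by simp
  moreover have "z \<bullet> y = 0" using z[OF y] by (simp add: orthogonal_def)
  ultimately have "z \<bullet> z = 0" using f' by (simp add: inner_add_right)
  moreover have "y \<in> S" using y by (simp only: span_eq_iff[THEN iffD2, OF S])
  ultimately show ?thesis using f' by simp
qed

text \<open>The projection along the orthogonal basis of \<open>W\<close>, i.e. onto \<open>W\<^sup>\<bottom>\<close>.\<close>

lemma subspace_complementary_projection:
  fixes W :: "(real^'n) set"
  assumes W: "subspace W"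
  obtains P where "linear P" "\<And>x. x - P x \<in> W" "\<And>w. w \<in> W \<Longrightarrow> P w = 0"
proof -
  obtain T where T: "T \<subseteq> W" "pairwise orthogonal T" "span T = W"
    using orthogonal_basis_subspace[OF W] by metis
  define P where "P x = x - (\<Sum>b\<in>T. (b \<bullet> x / (b \<bullet> b)) *\<^sub>R b)" for x :: "real^'n"
  have "P (x + y) = P x + P y" for x y
    by (simp add: P_def inner_add_right add_divide_distrib scaleR_add_left sum.distrib algebra_simps)
  moreover have "P (c *\<^sub>R x) = c *\<^sub>R P x" for c x
    by (simp add: P_def scaleR_diff_right scaleR_sum_right)
  ultimately have "linear P" by (rule linearI)
  moreover have P_compl: "x - P x \<in> W" for x
  proof -
    have "(\<Sum>b\<in>T. (b \<bullet> x / (b \<bullet> b)) *\<^sub>R b) \<in> span T"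
      by (intro span_sum span_scale span_base)
    then show ?thesis using T(3) by (simp add: P_def)
  qed
  moreover have "P w = 0" if w: "w \<in> W" for w
  proof -
    have "P w \<in> W" using subspace_diff[OF W w P_compl[of w]] by simp
    then have "orthogonal (P w) (P w)"
      using Gram_Schmidt_step[OF T(2), of "P w" w] T(3) by (simp add: P_def)
    then show ?thesis by (simp add: orthogonal_def)
  qed
  ultimately show ?thesis using that by blast
qed

text \<open>If \<open>P\<close> projects onto \<open>W\<^sup>\<bottom>\<close>, then \<open>z = P u\<close> solves \<open>z' = P L z\<close> with \<open>z(0) = 0\<close>,
  and Gronwall's inequality for \<open>|z|\<^sup>2\<close> gives \<open>z = 0\<close>.\<close>

lemma linear_ode_invariant_subspace:
  fixes u :: "real \<Rightarrow> real^'n" and L :: "real^'n^'n"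
  assumes der: "\<And>t. (u has_vector_derivative L *v u t) (at t)"
    and W: "subspace W" and invariant: "\<And>w. w \<in> W \<Longrightarrow> L *v w \<in> W" and u0: "u 0 \<in> W"
  shows "u t \<in> W"
proof -
  obtain P where P: "linear P" "\<And>x. x - P x \<in> W" "\<And>w. w \<in> W \<Longrightarrow> P w = 0"
    using subspace_complementary_projection[OF W] by blast
  have "linear (\<lambda>x. P (L *v x))"
    using linear_compose[OF matrix_vector_mul_linear P(1)] by (simp add: o_def)
  then obtain K where K: "\<And>x. norm (P (L *v x)) \<le> norm x * K"
    using bounded_linear.pos_bounded linear_conv_bounded_linear by blast
  define z where "z t = P (u t)" for t
  have PL: "P (L *v u t) = P (L *v z t)" for t
  proof -
    have "L *v u t = L *v (u t - z t) + L *v z t"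
      by (simp flip: matrix_vector_right_distrib)
    then show ?thesis
      using P invariant by (simp add: z_def linear_add)
  qed
  have "(z has_vector_derivative P (L *v u t)) (at t)" for t
    unfolding z_def
    by (rule bounded_linear.has_vector_derivative[OF linear_conv_bounded_linear[THEN iffD1, OF P(1)] der])
  then have dz: "(z has_vector_derivative P (L *v z t)) (at t)" for t
    by (simp only: PL)
  define g where "g t = z t \<bullet> z t" for t
  have dg: "(g has_real_derivative 2 * (z t \<bullet> P (L *v z t))) (at t)" for t
  proof -
    have "(g has_vector_derivative (z t \<bullet> P (L *v z t) + P (L *v z t) \<bullet> z t)) (at t)"
      unfolding g_def[abs_def]
      by (rule bounded_bilinear.has_vector_derivative[OF bounded_bilinear_inner dz dz])
    then show ?thesis by (simp add: has_real_derivative_iff_has_vector_derivative inner_commute)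
  qed
  have bound: "\<bar>2 * (z t \<bullet> P (L *v z t))\<bar> \<le> (2 * K) * g t" for t
  proof -
    have "\<bar>z t \<bullet> P (L *v z t)\<bar> \<le> norm (z t) * norm (P (L *v z t))"
      by (rule Cauchy_Schwarz_ineq2)
    also have "\<dots> \<le> norm (z t) * (norm (z t) * K)"
      by (rule mult_left_mono[OF K]) simp
    also have "\<dots> = K * g t"
      by (simp add: g_def power2_norm_eq_inner[symmetric] power2_eq_square)
    finally show ?thesis by simp
  qed
  have "g 0 = 0" using P(3)[OF u0] by (simp add: g_def z_def)
  from gronwall_zero[OF dg bound _ this] have "g t = 0" by (simp add: g_def)
  then show ?thesis using P(2)[of "u t"] by (simp add: g_def z_def)
qed

section \<open>The inertial regressor \<open>k\<close>\<close>

definition polar_form :: "(real^sp \<Rightarrow> real^10) \<Rightarrow> real^sp \<Rightarrow> real^sp \<Rightarrow> real^10" where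
  "polar_form k v w = (1/4) *\<^sub>R (k (v + w) - k (v - w))"

lemma row_Cmat: "row c (Cmat V \<Phi>) = (\<chi> l. column c V \<bullet> (hat (axis l 1) *v \<Phi>))"
  by (simp add: row_def Cmat_def matrix_def matrix_vector_mult_def transpose_def column_def
      inner_vec_def mult.commute)

locale inertial_regressor =
  fixes k :: "real^sp \<Rightarrow> real^10"
  assumes inner_k: "\<And>v \<pi>. v \<bullet> (hat \<pi> *v v) = k v \<bullet> \<pi>"
begin

lemma inner_polar_form: "polar_form k v w \<bullet> p = v \<bullet> (hat p *v w)"
proof -
  have "(v + w) \<bullet> (hat p *v (v + w)) - (v - w) \<bullet> (hat p *v (v - w)) =
      2 * (v \<bullet> (hat p *v w)) + 2 * (w \<bullet> (hat p *v v))"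
    by (simp only: matrix_vector_right_distrib matrix_vector_mult_diff_distrib inner_add_left
        inner_add_right inner_diff_left inner_diff_right)
  then show ?thesis
    by (simp add: polar_form_def inner_diff_left inner_k[symmetric] inner_hat_commute[of w p v])
qed

lemma polar_form_diag: "polar_form k v v = k v"
  by (rule vector_eq_rdot[THEN iffD1]) (simp add: inner_polar_form inner_k)

lemma linear_polar_form: "linear (\<lambda>v. polar_form k v w)"
  by (rule linearI; rule vector_eq_rdot[THEN iffD1])
    (simp_all add: inner_polar_form inner_add_left inner_add_right inner_scaleR_left
      matrix_vector_mult_add_rdistrib)

lemma k_add_scaleR:
  "k (a + s *\<^sub>R b) = k a + (2 * s) *\<^sub>R polar_form k a b + (s * s) *\<^sub>R k b"
proof (rule vector_eq_rdot[THEN iffD1], rule allI)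
  fix p
  have "k (a + s *\<^sub>R b) \<bullet> p = a \<bullet> (hat p *v a) + s * (a \<bullet> (hat p *v b)) +
      (s * (b \<bullet> (hat p *v a)) + s * s * (b \<bullet> (hat p *v b)))"
    by (simp only: inner_k[symmetric] matrix_vector_right_distrib matrix_vector_mult_scaleR
        inner_add_left inner_add_right inner_scaleR_left inner_scaleR_right) (simp add: algebra_simps)
  also have "\<dots> = a \<bullet> (hat p *v a) + 2 * s * (a \<bullet> (hat p *v b)) + s * s * (b \<bullet> (hat p *v b))"
    by (simp add: inner_hat_commute[of b p a] algebra_simps)
  also have "\<dots> = (k a + (2 * s) *\<^sub>R polar_form k a b + (s * s) *\<^sub>R k b) \<bullet> p"
    by (simp only: inner_add_left inner_scaleR_left inner_polar_form inner_k)
  finally show "k (a + s *\<^sub>R b) \<bullet> p = (k a + (2 * s) *\<^sub>R polar_form k a b + (s * s) *\<^sub>R k b) \<bullet> p" .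
qed

lemma rows_Cmat: "rows (Cmat V \<Phi>) = (\<lambda>x. polar_form k x \<Phi>) ` columns V"
proof -
  have "row c (Cmat V \<Phi>) = polar_form k (column c V) \<Phi>" for c
    by (simp add: row_Cmat vec_eq_iff inner_polar_form[symmetric] inner_axis)
  then show ?thesis by (auto simp: rows_def columns_def)
qed

lemma span_rows_Cmat:
  assumes "span (columns V) = W"
  shows "span (rows (Cmat V \<Phi>)) = span ((\<lambda>x. polar_form k x \<Phi>) ` W)"
  using assms[symmetric]
  by (simp only: rows_Cmat span_linear_image[OF linear_polar_form, symmetric] span_span)

lemma k_congruence:
  assumes hat_vee: "\<And>p. hat (vee (transpose M ** hat p ** M)) = transpose M ** hat p ** M"
  shows "k (M *v v) = transpose (Bmat (transpose M)) *v k v"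
proof (rule vector_eq_rdot[THEN iffD1], rule allI)
  fix p
  have "k (M *v v) \<bullet> p = (hat p *v (M *v v)) \<bullet> (M *v v)"
    by (simp add: inner_k[symmetric] inner_commute[of "hat p *v (M *v v)"])
  also have "\<dots> = (transpose M *v (hat p *v (M *v v))) \<bullet> v"
    by (rule inner_matrix_vector_mult)
  also have "\<dots> = v \<bullet> ((transpose M ** hat p ** M) *v v)"
    by (simp only: matrix_vector_mul_assoc matrix_mul_assoc inner_commute)
  also have "\<dots> = v \<bullet> (hat (vee (transpose M ** hat p ** M)) *v v)"
    by (simp only: hat_vee)
  also have "\<dots> = k v \<bullet> (Bmat (transpose M) *v p)"
    by (simp add: inner_k Bmat_mult_vec)
  also have "\<dots> = (transpose (Bmat (transpose M)) *v k v) \<bullet> p"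
    by (simp add: dot_lmul_matrix)
  finally show "k (M *v v) \<bullet> p = (transpose (Bmat (transpose M)) *v k v) \<bullet> p" .
qed

lemma k_euclidean_representation: "k x = (\<Sum>e\<in>Basis. (x \<bullet> (hat e *v x)) *\<^sub>R e)"
  by (simp add: inner_k euclidean_representation)

lemma has_vector_derivative_k_rigid_motion:
  fixes F :: "real \<Rightarrow> real^sp^sp" and y :: "real^sp"
  assumes dF: "(F has_vector_derivative (- (crossM v ** F t))) (at t)"
  shows "((\<lambda>s. k (F s *v y)) has_vector_derivative (- (transpose (Amat v) *v k (F t *v y)))) (at t)"
proof -
  define w where "w s = F s *v y" for s
  define C where "C = crossM v"
  have "bounded_linear (\<lambda>M::real^sp^sp. M *v y)"
    by (simp add: linear_conv_bounded_linear[symmetric] linearI matrix_vector_mult_add_rdistrib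
        scaleR_matrix_vector_assoc[symmetric])
  from bounded_linear.has_vector_derivative[OF this dF]
  have dw: "(w has_vector_derivative - (C *v w t)) (at t)"
    by (simp add: w_def[abs_def] C_def uminus_matrix_vector_mult matrix_vector_mul_assoc[symmetric])
  define d where "d e = w t \<bullet> (hat e *v - (C *v w t)) + - (C *v w t) \<bullet> (hat e *v w t)" for e
  have "((\<lambda>s. w s \<bullet> (hat e *v w s)) has_vector_derivative d e) (at t)" for e
    using bounded_bilinear.has_vector_derivative[OF bounded_bilinear_inner dw
        bounded_linear.has_vector_derivative[OF matrix_vector_mul_bounded_linear dw]]
    by (simp add: d_def)
  then have "((\<lambda>s. \<Sum>e\<in>Basis. (w s \<bullet> (hat e *v w s)) *\<^sub>R e) has_vector_derivative
      (\<Sum>e\<in>Basis. d e *\<^sub>R e)) (at t)"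
    by (intro has_vector_derivative_sum
        bounded_linear.has_vector_derivative[OF bounded_linear_scaleR_left])
  moreover have "d e = (- (transpose (Amat v) *v k (w t))) \<bullet> e" for e
  proof -
    have "(- (transpose (Amat v) *v k (w t))) \<bullet> e = - (k (w t) \<bullet> (Amat v *v e))"
      by (simp add: inner_matrix_vector_mult)
    also have "\<dots> = - (w t \<bullet> (hat (Amat v *v e) *v w t))"
      by (simp add: inner_k)
    also have "hat (Amat v *v e) = transpose C ** hat e + hat e ** C"
      by (simp add: Amat_mult_vec hat_vee_crossM C_def)
    also have "- (w t \<bullet> ((transpose C ** hat e + hat e ** C) *v w t)) =
        - ((C *v w t) \<bullet> (hat e *v w t) + w t \<bullet> (hat e *v (C *v w t)))"
      by (simp add: matrix_vector_mult_add_rdistrib inner_add_right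
          matrix_vector_mul_assoc[symmetric] inner_vector_matrix_mult)
    also have "\<dots> = d e"
      by (simp add: d_def inner_minus_left inner_minus_right matrix_vector_mult_uminus)
    finally show ?thesis by simp
  qed
  then have "(\<Sum>e\<in>Basis. d e *\<^sub>R e) = - (transpose (Amat v) *v k (w t))"
    by (simp only: euclidean_representation)
  ultimately show ?thesis
    by (simp add: k_euclidean_representation[symmetric] w_def)
qed

end

section \<open>Velocities of the chain\<close>

lemma vel_fun_upd_below:
  "n < m \<Longrightarrow> vel XJ XT Phi (q(m := a)) (qd(m := b)) n = vel XJ XT Phi q qd n"
  by (induction n) auto

lemma vel_zero_rates: "vel XJ XT Phi q (\<lambda>_. 0) n = 0"
  by (induction n) auto

lemma vel_Suc_fun_upd:
  "vel XJ XT Phi (q(Suc n := a)) (qd(Suc n := b)) (Suc n) =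
     XJ (Suc n) a *v (XT (Suc n) *v vel XJ XT Phi q qd n) + b *\<^sub>R Phi (Suc n)"
  by (simp add: vel_fun_upd_below matrix_vector_mul_assoc)

lemma vel_Suc:
  "vel XJ XT Phi q qd (Suc n) =
     XJ (Suc n) (q (Suc n)) *v (XT (Suc n) *v vel XJ XT Phi q qd n) + qd (Suc n) *\<^sub>R Phi (Suc n)"
  using vel_Suc_fun_upd[of XJ XT Phi q n "q (Suc n)" qd "qd (Suc n)"] by simp

lemma subspace_Kspace: "subspace (Kspace k XJ XT Phi i)"
  by (simp add: Kspace_def)

locale chain_joint = inertial_regressor k
  for k :: "real^sp \<Rightarrow> real^10" +
  fixes XJ :: "nat \<Rightarrow> real \<Rightarrow> real^sp^sp" and XT :: "nat \<Rightarrow> real^sp^sp"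
    and Phi :: "nat \<Rightarrow> real^sp" and n :: nat
  assumes XT_spatial: "spatial_transform (XT (Suc n))"
    and XJ_zero: "XJ (Suc n) 0 = mat 1"
    and XJ_deriv: "\<And>t. (XJ (Suc n) has_vector_derivative (- (crossM (Phi (Suc n)) ** XJ (Suc n) t))) (at t)"
begin

abbreviation "AT \<equiv> transpose (Amat (Phi (Suc n)))"
abbreviation "BT \<equiv> transpose (Bmat (transpose (XT (Suc n))))"
abbreviation "K \<equiv> Kspace k XJ XT Phi (Suc n)"

lemma k_in_Kspace: "k (vel XJ XT Phi q qd (Suc n)) \<in> K"
  unfolding Kspace_def by (rule span_base) blast

lemma k_joint_motion:
  "((\<lambda>s. k (XJ (Suc n) s *v y)) has_vector_derivative - (AT *v k (XJ (Suc n) t *v y))) (at t)"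
  by (rule has_vector_derivative_k_rigid_motion[OF XJ_deriv])

lemma k_joint_start: "k (XJ (Suc n) 0 *v (XT (Suc n) *v v)) = BT *v k v"
  using k_congruence[OF hat_vee_spatial_congruence[OF XT_spatial]] by (simp add: XJ_zero)

text \<open>Every derivative of \<open>t \<mapsto> k(X\<^sub>J(t) X v\<^sub>i\<^sub>-\<^sub>1)\<close> lies in \<open>K\<^sub>i\<close>, since the curve does.\<close>

lemma mpow_k_joint_in_Kspace:
  "mpow AT j *v k (XJ (Suc n) t *v (XT (Suc n) *v vel XJ XT Phi q qd n)) \<in> K"
proof (induction j arbitrary: t)
  case 0
  from k_in_Kspace[of "q(Suc n := t)" "qd(Suc n := 0)"] show ?case
    by (simp only: vel_Suc_fun_upd scaleR_zero_left add_0_right mpow.simps matrix_vector_mul_lid)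
next
  case (Suc j)
  have "((\<lambda>s. mpow AT j *v k (XJ (Suc n) s *v (XT (Suc n) *v vel XJ XT Phi q qd n)))
      has_vector_derivative
        mpow AT j *v - (AT *v k (XJ (Suc n) t *v (XT (Suc n) *v vel XJ XT Phi q qd n)))) (at t)"
    by (rule bounded_linear.has_vector_derivative[OF matrix_vector_mul_bounded_linear k_joint_motion])
  from has_vector_derivative_in_subspace[OF subspace_Kspace Suc.IH this]
  have "- (mpow AT (Suc j) *v k (XJ (Suc n) t *v (XT (Suc n) *v vel XJ XT Phi q qd n))) \<in> K"
    by (simp only: matrix_vector_mult_uminus mpow.simps matrix_vector_mul_assoc)
  from subspace_neg[OF subspace_Kspace this] show ?case by simp
qed

lemma krylov_subset_Kspace: "krylov m AT ((*v) BT ` Kspace k XJ XT Phi n) \<subseteq> K"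
  unfolding krylov_def
proof (rule span_minimal, safe)
  fix j c assume "c \<in> Kspace k XJ XT Phi n"
  then show "mpow AT j *v (BT *v c) \<in> K"
    unfolding Kspace_def[of k XJ XT Phi n]
  proof (induction rule: span_induct)
    case base
    have "linear (\<lambda>c. mpow AT j *v (BT *v c))"
      by (rule linearI) (simp_all add: matrix_vector_right_distrib matrix_vector_mult_scaleR)
    from linear_subspace_vimage[OF this subspace_Kspace] show ?case
      by (simp add: vimage_def)
  next
    case (step x)
    then obtain q qd where "x = k (vel XJ XT Phi q qd n)" by blast
    then have "BT *v x = k (XJ (Suc n) 0 *v (XT (Suc n) *v vel XJ XT Phi q qd n))"
      by (simp only: k_joint_start)
    with mpow_k_joint_in_Kspace[of j 0 q qd] show ?case by (simp only:)
  qed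
qed (rule subspace_Kspace)

lemma polar_form_in_Kspace:
  assumes "x \<in> Vspace XJ XT Phi (Suc n)"
  shows "polar_form k x (Phi (Suc n)) \<in> K"
  using assms unfolding Vspace_def
proof (induction rule: span_induct)
  case base
  from linear_subspace_vimage[OF linear_polar_form subspace_Kspace] show ?case
    by (simp add: vimage_def)
next
  case (step x)
  then obtain q qd where x: "x = vel XJ XT Phi q qd (Suc n)" by blast
  have "x + s *\<^sub>R Phi (Suc n) = vel XJ XT Phi q (qd(Suc n := qd (Suc n) + s)) (Suc n)" for s
    using vel_Suc_fun_upd[of XJ XT Phi q n "q (Suc n)" qd "qd (Suc n) + s"]
      vel_Suc_fun_upd[of XJ XT Phi q n "q (Suc n)" qd "qd (Suc n)"]
    by (simp del: vel.simps add: x scaleR_add_left)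
  from this[of 1] this[of "-1"]
  have plus: "x + Phi (Suc n) = vel XJ XT Phi q (qd(Suc n := qd (Suc n) + 1)) (Suc n)"
    and minus: "x - Phi (Suc n) = vel XJ XT Phi q (qd(Suc n := qd (Suc n) + -1)) (Suc n)"
    by (simp_all del: vel.simps)
  show ?case
    unfolding polar_form_def plus minus
    by (intro subspace_scale[OF subspace_Kspace] subspace_diff[OF subspace_Kspace] k_in_Kspace)
qed

text \<open>The curve \<open>t \<mapsto> k(X\<^sub>J(t) X v)\<close> solves \<open>u' = -A\<^sup>T u\<close> and starts in \<open>B\<^sup>T K\<^sub>i\<^sub>-\<^sub>1\<close>.\<close>

lemma k_joint_in_krylov:
  "k (XJ (Suc n) t *v (XT (Suc n) *v vel XJ XT Phi q qd n))
     \<in> krylov CARD(10) AT ((*v) BT ` Kspace k XJ XT Phi n)"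
proof (rule linear_ode_invariant_subspace[where L = "- AT"])
  show "((\<lambda>s. k (XJ (Suc n) s *v (XT (Suc n) *v vel XJ XT Phi q qd n))) has_vector_derivative
      (- AT) *v k (XJ (Suc n) t *v (XT (Suc n) *v vel XJ XT Phi q qd n))) (at t)" for t
    using k_joint_motion by (simp add: uminus_matrix_vector_mult)
  show "(- AT) *v w \<in> krylov CARD(10) AT ((*v) BT ` Kspace k XJ XT Phi n)"
    if "w \<in> krylov CARD(10) AT ((*v) BT ` Kspace k XJ XT Phi n)" for w
    using krylov_invariant[OF that] by (simp add: uminus_matrix_vector_mult krylov_def span_neg)
  have "k (vel XJ XT Phi q qd n) \<in> Kspace k XJ XT Phi n"
    unfolding Kspace_def by (rule span_base) blast
  then have "BT *v k (vel XJ XT Phi q qd n) \<in> krylov CARD(10) AT ((*v) BT ` Kspace k XJ XT Phi n)"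
    using subset_krylov[of "CARD(10)" "(*v) BT ` Kspace k XJ XT Phi n" AT] by auto
  then show "k (XJ (Suc n) 0 *v (XT (Suc n) *v vel XJ XT Phi q qd n))
      \<in> krylov CARD(10) AT ((*v) BT ` Kspace k XJ XT Phi n)"
    by (simp only: k_joint_start)
qed (simp add: krylov_def)

lemma Kspace_Suc_eq:
  "K = span (krylov 10 AT ((*v) BT ` Kspace k XJ XT Phi n)
             \<union> (\<lambda>x. polar_form k x (Phi (Suc n))) ` Vspace XJ XT Phi (Suc n))"
proof
  show "span (krylov 10 AT ((*v) BT ` Kspace k XJ XT Phi n)
      \<union> (\<lambda>x. polar_form k x (Phi (Suc n))) ` Vspace XJ XT Phi (Suc n)) \<subseteq> K"
    using krylov_subset_Kspace polar_form_in_Kspace by (intro span_minimal subspace_Kspace) blast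
  show "K \<subseteq> span (krylov 10 AT ((*v) BT ` Kspace k XJ XT Phi n)
      \<union> (\<lambda>x. polar_form k x (Phi (Suc n))) ` Vspace XJ XT Phi (Suc n))"
    unfolding Kspace_def[of k XJ XT Phi "Suc n"]
  proof (rule span_minimal[OF _ subspace_span], safe)
    fix q qd
    let ?y = "XJ (Suc n) (q (Suc n)) *v (XT (Suc n) *v vel XJ XT Phi q qd n)"
    have "?y = vel XJ XT Phi q (qd(Suc n := 0)) (Suc n)"
      using vel_Suc_fun_upd[of XJ XT Phi q n "q (Suc n)" qd 0] by (simp del: vel.simps)
    then have y: "?y \<in> Vspace XJ XT Phi (Suc n)"
      unfolding Vspace_def by (blast intro: span_base)
    have "Phi (Suc n) = vel XJ XT Phi q ((\<lambda>_. 0)(Suc n := 1)) (Suc n)"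
      using vel_Suc_fun_upd[of XJ XT Phi q n "q (Suc n)" "\<lambda>_. 0" 1]
      by (simp del: vel.simps add: vel_zero_rates)
    then have Phi: "Phi (Suc n) \<in> Vspace XJ XT Phi (Suc n)"
      unfolding Vspace_def by (blast intro: span_base)
    have k_vel: "k (vel XJ XT Phi q qd (Suc n)) = k ?y + (2 * qd (Suc n)) *\<^sub>R polar_form k ?y (Phi (Suc n))
        + (qd (Suc n) * qd (Suc n)) *\<^sub>R polar_form k (Phi (Suc n)) (Phi (Suc n))"
      by (simp only: vel_Suc k_add_scaleR polar_form_diag)
    let ?S = "krylov 10 AT ((*v) BT ` Kspace k XJ XT Phi n)
      \<union> (\<lambda>x. polar_form k x (Phi (Suc n))) ` Vspace XJ XT Phi (Suc n)"
    have "k ?y \<in> ?S"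
      using k_joint_in_krylov by simp
    moreover have "polar_form k ?y (Phi (Suc n)) \<in> ?S" "polar_form k (Phi (Suc n)) (Phi (Suc n)) \<in> ?S"
      using y Phi by blast+
    ultimately show "k (vel XJ XT Phi q qd (Suc n)) \<in> span ?S"
      unfolding k_vel by (intro span_add span_scale span_base)
  qed
qed

end

section \<open>Rows of the stacked matrix\<close>

lemma span_Un_span: "span (span A \<union> span B) = span (A \<union> B)"
  by (simp add: span_Un span_span)

lemma Range_eq_span_columns: "Range (M::real^'c^'r) = span (columns M)"
proof -
  have "columns M \<subseteq> Range M"
    by (auto simp: Range_def columns_def matrix_vector_mult_basis[symmetric])
  moreover have "subspace (Range M)"
    unfolding Range_def by (rule linear_subspace_image[OF matrix_vector_mul_linear subspace_UNIV])
  ultimately have "span (columns M) \<subseteq> Range M" by (rule span_minimal)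
  moreover have "Range M \<subseteq> span (columns M)"
    using matrix_vector_mult_in_columnspace by (auto simp: Range_def)
  ultimately show ?thesis by blast
qed

lemma Range_transpose_eq_span_rows: "Range (transpose (M::real^'c^'r)) = span (rows M)"
  by (simp add: Range_eq_span_columns)

lemma row_matrix_mult: "row r (D ** M) = transpose M *v row r (D::real^'n^'m)"
  by (simp add: row_def vec_eq_iff matrix_matrix_mult_def matrix_vector_mult_def transpose_def
      mult.commute)

lemma rows_matrix_mult: "rows (D ** M) = (*v) (transpose M) ` rows (D::real^'n^'m)"
  by (auto simp: rows_def row_matrix_mult)

lemma range_nat_Rep_bit0_10: "range (\<lambda>j::10. nat (Rep_bit0 j)) = {..<10}"
proof -
  have "range (Rep_bit0 :: 10 \<Rightarrow> int) = {0..<2 * int CARD(5)}"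
    by (rule type_definition.Rep_range[OF type_definition_bit0])
  then have Rep: "range (Rep_bit0 :: 10 \<Rightarrow> int) = {0..<10}" by simp
  show ?thesis
  proof (intro set_eqI iffI)
    show "m \<in> {..<10}" if "m \<in> range (\<lambda>j::10. nat (Rep_bit0 j))" for m
    proof -
      from that obtain j :: 10 where "m = nat (Rep_bit0 j)" by blast
      moreover have "Rep_bit0 j \<in> {0..<10}" using Rep by blast
      ultimately show ?thesis by auto
    qed
    show "m \<in> range (\<lambda>j::10. nat (Rep_bit0 j))" if "m \<in> {..<10}" for m
    proof -
      from that Rep obtain j :: 10 where "Rep_bit0 j = int m"
        by (metis atLeastLessThan_iff imageE lessThan_iff of_nat_0_le_iff of_nat_less_numeral_iff)
      then show ?thesis by (metis nat_int rangeI)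
    qed
  qed
qed

lemma rows_stackC:
  "rows (stackC D A Cv) = {mpow (transpose A) j *v x | j x. j < 10 \<and> x \<in> rows D} \<union> rows Cv"
    (is "_ = ?K \<union> _")
proof (intro equalityI subsetI)
  have row_Inl: "row (Inl (j, r)) (stackC D A Cv) = mpow (transpose A) (nat (Rep_bit0 j)) *v row r D"
    for j r
  proof -
    have "row (Inl (j, r)) (stackC D A Cv) = row r (D ** mpow A (nat (Rep_bit0 j)))"
      by (simp add: row_def stackC_def)
    then show ?thesis by (simp add: row_matrix_mult transpose_mpow)
  qed
  have row_Inr: "row (Inr c) (stackC D A Cv) = row c Cv" for c
    by (simp add: row_def stackC_def)
  fix y
  show "y \<in> ?K \<union> rows Cv" if "y \<in> rows (stackC D A Cv)"
  proof -
    from that obtain x where y: "y = row x (stackC D A Cv)" by (auto simp: rows_def)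
    show ?thesis
    proof (cases x)
      case (Inl p)
      obtain j r where "p = (j, r)" by (cases p)
      moreover have "nat (Rep_bit0 j) < 10" using range_nat_Rep_bit0_10 by blast
      ultimately show ?thesis using y Inl row_Inl by (auto simp: rows_def)
    next
      case (Inr c)
      then show ?thesis using y row_Inr by (auto simp: rows_def)
    qed
  qed
  show "y \<in> rows (stackC D A Cv)" if "y \<in> ?K \<union> rows Cv"
    using that
  proof
    assume "y \<in> ?K"
    then obtain m r where y: "y = mpow (transpose A) m *v row r D" and "m < 10"
      by (auto simp: rows_def)
    then obtain j :: 10 where "nat (Rep_bit0 j) = m"
      using range_nat_Rep_bit0_10 by (metis imageE lessThan_iff)
    then have "y = row (Inl (j, r)) (stackC D A Cv)" by (simp add: y row_Inl)
    then show ?thesis by (auto simp: rows_def)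
  next
    assume "y \<in> rows Cv"
    then obtain c where "y = row (Inr c) (stackC D A Cv)" by (auto simp: rows_def row_Inr)
    then show ?thesis by (auto simp: rows_def)
  qed
qed

lemma krylov_rows_matrix_mult:
  assumes "span (rows C) = S"
  shows "krylov m M (rows (C ** B)) = krylov m M ((*v) (transpose B) ` S)"
proof -
  have "krylov m M (rows (C ** B)) = krylov m M (span ((*v) (transpose B) ` rows C))"
    by (simp only: rows_matrix_mult krylov_span)
  also have "\<dots> = krylov m M ((*v) (transpose B) ` S)"
    using assms by (simp only: span_linear_image[OF matrix_vector_mul_linear])
  finally show ?thesis .
qed

lemma span_rows_stackC:
  "span (rows (stackC D A Cv)) = span (krylov 10 (transpose A) (rows D) \<union> rows Cv)"
  unfolding rows_stackC krylov_def
  by (simp only: span_Un_span[of _ "rows Cv", symmetric] span_span)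

theorem lemma2:
  fixes N i :: nat
    and Phi :: "nat \<Rightarrow> real^sp"
    and XJ :: "nat \<Rightarrow> real \<Rightarrow> real^sp^sp"
    and XT :: "nat \<Rightarrow> real^sp^sp"
    and k :: "real^sp \<Rightarrow> real^10"
    and V :: "real^'k^sp"
    and Cprev :: "real^10^'r"
  assumes XT_spatial: "\<And>j. j \<in> {1..N} \<Longrightarrow> spatial_transform (XT j)"
    and XJ_zero: "\<And>j. j \<in> {1..N} \<Longrightarrow> XJ j 0 = mat 1"
    and XJ_deriv: "\<And>j t. j \<in> {1..N} \<Longrightarrow>
          (XJ j has_vector_derivative (- (crossM (Phi j) ** XJ j t))) (at t)"
    and k_def: "\<And>v \<pi>. v \<bullet> (hat \<pi> *v v) = k v \<bullet> \<pi>"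
    and i: "i \<in> {1..N}"
    and V: "Range V = Vspace XJ XT Phi i"
    and Cprev: "Range (transpose Cprev) = Kspace k XJ XT Phi (i - 1)"
  shows "Range (transpose (stackC (Cprev ** Bmat (transpose (XT i))) (Amat (Phi i)) (Cmat V (Phi i))))
           = Kspace k XJ XT Phi i"
proof -
  obtain n where n: "i = Suc n" using i by (cases i) auto
  interpret chain_joint k XJ XT Phi n
    by unfold_locales (use k_def XT_spatial[OF i] XJ_zero[OF i] XJ_deriv[OF i] n in simp_all)
  have "span (rows Cprev) = Kspace k XJ XT Phi n"
    using Cprev by (simp add: Range_transpose_eq_span_rows n)
  then have krylov_rows: "krylov 10 AT (rows (Cprev ** Bmat (transpose (XT (Suc n)))))
      = krylov 10 AT ((*v) BT ` Kspace k XJ XT Phi n)"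
    by (rule krylov_rows_matrix_mult)
  have "span (columns V) = Vspace XJ XT Phi (Suc n)"
    using V by (simp add: Range_eq_span_columns n)
  then have Cmat_rows: "span (rows (Cmat V (Phi (Suc n))))
      = span ((\<lambda>x. polar_form k x (Phi (Suc n))) ` Vspace XJ XT Phi (Suc n))"
    by (rule span_rows_Cmat)
  have "Range (transpose (stackC (Cprev ** Bmat (transpose (XT (Suc n)))) (Amat (Phi (Suc n)))
      (Cmat V (Phi (Suc n))))) = span (span (krylov 10 AT (rows (Cprev ** Bmat (transpose (XT (Suc n))))))
      \<union> span (rows (Cmat V (Phi (Suc n)))))"
    by (simp only: Range_transpose_eq_span_rows span_rows_stackC span_Un_span)
  also have "\<dots> = Kspace k XJ XT Phi (Suc n)"
    by (simp only: krylov_rows Cmat_rows span_Un_span Kspace_Suc_eq)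
  finally show ?thesis by (simp only: n)
qed

end
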